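(* Let $\mathcal{V}$ be a finite nonempty set and let $p_h, p_h', p_m$ be probability distributions on $\mathcal{V}$. Let $g(\lambda) = \mathbb{KL}\big(p_h \,\|\, (1+\lambda)p_h' - \lambda p_m\big)$, defined for $\lambda$ in the closed interval $I$ of all real $\lambda$ such that $(1+\lambda)p_h' - \lambda p_m$ is a probability distribution on $\mathcal{V}$. If $g'(0) < 0$, then the minimum point $\lambda_*$ of $g$ on $I$ satisfies $\lambda_* > 0$, and for every $\lambda \in (0, \lambda_*]$, $$\mathbb{KL}\big(p_h \,\|\, (1+\lambda)p_h' - \lambda p_m\big) < \mathbb{KL}\big(p_h \,\|\, p_h'\big).$$
   Context: For probability distributions $p, q$ on a finite set $\mathcal{V}$, $\mathbb{KL}(p\|q) = \sum_{v\in\mathcal{V}} p(v)\log\frac{p(v)}{q(v)} \in [0,+\infty]$, with the usual conventions that terms with $p(v)=0$ contribute $0$ and that the value is $+\infty$ if $p(v)>0=q(v)$ for some $v$. The domain of $g$ is $I = \bigcap_{v\in\mathcal{V}}\{\lambda\in\mathbb{R} : 0 \le (1+\lambda)p_h'(v) - \lambda p_m(v) \le 1\}$, a closed interval containing $[-1,0]$. The notation $g'(0)$ means the ordinary two-sided derivative at $0$, so the hypothesis $g'(0)<0$ includes that $0$ is an interior point of $I$, that $g$ is finite near $0$, and that $g$ is differentiable at $0$. A minimum point of $g$ is a point of $I$ at which $g$ attains its minimum over $I$; when $g$ is not constant on $I$ (in particular when $g'(0)<0$) it is unique and is denoted $\lambda_*$. *)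

theory Defs
  imports "HOL-Analysis.Analysis"
begin

definition prob_dist :: "'v set \<Rightarrow> ('v \<Rightarrow> real) \<Rightarrow> bool" where
  "prob_dist V p \<longleftrightarrow> (\<forall>v\<in>V. 0 \<le> p v) \<and> (\<Sum>v\<in>V. p v) = 1"

(* Extended-real valued; meaningful when p and q are nonnegative on V. The library's
   KL_divergence is real valued and so cannot express the value +infinity. *)
definition KL :: "'v set \<Rightarrow> ('v \<Rightarrow> real) \<Rightarrow> ('v \<Rightarrow> real) \<Rightarrow> ereal" where
  "KL V p q =
    (if \<exists>v\<in>V. p v > 0 \<and> q v = 0 then \<infinity>
     else ereal (\<Sum>v\<in>V. if p v = 0 then 0 else p v * ln (p v / q v)))"

definition extrapolate :: "('v \<Rightarrow> real) \<Rightarrow> ('v \<Rightarrow> real) \<Rightarrow> real \<Rightarrow> 'v \<Rightarrow> real" where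
  "extrapolate p' pm l = (\<lambda>v. (1 + l) * p' v - l * pm v)"

definition admissible :: "'v set \<Rightarrow> ('v \<Rightarrow> real) \<Rightarrow> ('v \<Rightarrow> real) \<Rightarrow> real set" where
  "admissible V p' pm = {l. prob_dist V (extrapolate p' pm l)}"

lemma admissible_eq_Inter:
  assumes "finite V" and "prob_dist V p'" and "prob_dist V pm"
  shows "admissible V p' pm =
    (\<Inter>v\<in>V. {l. 0 \<le> (1 + l) * p' v - l * pm v \<and> (1 + l) * p' v - l * pm v \<le> 1})"
proof -
  have total: "(\<Sum>v\<in>V. extrapolate p' pm l v) = 1" for l
    using assms
    by (simp add: prob_dist_def extrapolate_def sum_subtractf sum_distrib_left [symmetric])
  have "extrapolate p' pm l v \<le> 1"
    if "\<forall>v\<in>V. 0 \<le> extrapolate p' pm l v" and "v \<in> V" for l v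
    using member_le_sum [of v V "extrapolate p' pm l"] that total [of l] assms(1) by auto
  then show ?thesis
    unfolding admissible_def prob_dist_def using total
    by (auto simp: extrapolate_def)
qed

end

theory Submission
  imports Defs
begin

text \<open>
  \<open>KL V p\<close> is strictly convex, where finite, in every direction that moves the second argument
  somewhere on the support of \<open>p\<close>. Up to a positive factor, \<open>exp (- KL V p q)\<close> is the product
  of \<open>q v powr p v\<close> over the support of \<open>p\<close>, which is continuous in \<open>q\<close> also where it vanishes,
  so \<open>KL V p\<close> attains its minimum on compact families. Since \<open>D \<noteq> 0\<close>, the line \<open>extrapolate p_h' p_m\<close> moves
  on the support of \<open>p_h\<close>; this makes the admissible set compact and \<open>g\<close> strictly convex. So the
  minimiser exists uniquely. As \<open>g\<close> drops below \<open>g 0\<close> immediately to the right of \<open>0\<close>, convexity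
  puts the minimiser there, and the chord from \<open>0\<close> to it bounds \<open>g\<close> strictly below \<open>g 0\<close>.
\<close>

text \<open>The bound \<open>ln z \<le> z - 1\<close>, taken at \<open>x / m\<close> and
  \<open>y / m\<close> with \<open>m\<close> the weighted mean, has weighted right-hand sides
  summing to 0. Equality holds only at \<open>z = 1\<close>, which gives the strict version.\<close>

lemma ln_concave_le:
  fixes x y t :: real
  assumes "0 < x" "0 < y" "0 < t" "t < 1"
  shows "(1 - t) * ln x + t * ln y \<le> ln ((1 - t) * x + t * y)"
    and "x \<noteq> y \<Longrightarrow> (1 - t) * ln x + t * ln y < ln ((1 - t) * x + t * y)"
proof -
  define m where "m = (1 - t) * x + t * y"
  have m: "0 < m" using assms by (simp add: m_def add_pos_pos)
  have sum0: "(1 - t) * (x / m - 1) + t * (y / m - 1) = 0"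
    using m by (simp add: field_simps) (simp add: m_def algebra_simps)
  have lnx: "ln x - ln m = ln (x / m)" and lny: "ln y - ln m = ln (y / m)"
    using assms m by (simp_all add: ln_div)
  have lex: "(1 - t) * ln (x / m) \<le> (1 - t) * (x / m - 1)"
    using assms m by (intro mult_left_mono ln_le_minus_one) auto
  have ley: "t * ln (y / m) \<le> t * (y / m - 1)"
    using assms m by (intro mult_left_mono ln_le_minus_one) auto
  have split: "(1 - t) * ln x + t * ln y - ln m = (1 - t) * ln (x / m) + t * ln (y / m)"
    by (simp add: lnx [symmetric] lny [symmetric] algebra_simps)
  show "(1 - t) * ln x + t * ln y \<le> ln ((1 - t) * x + t * y)"
    using lex ley sum0 split unfolding m_def by linarith
  assume "x \<noteq> y"
  moreover have "y - m = (1 - t) * (y - x)" by (simp add: m_def algebra_simps)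
  ultimately have "y / m \<noteq> 1" using m assms by auto
  then have "ln (y / m) < y / m - 1"
    using ln_eq_minus_one [of "y / m"] ln_le_minus_one [of "y / m"] m assms by force
  then have "t * ln (y / m) < t * (y / m - 1)" using assms by simp
  then show "(1 - t) * ln x + t * ln y < ln ((1 - t) * x + t * y)"
    using lex sum0 split unfolding m_def by linarith
qed

lemma KL_eq_sum:
  assumes "finite V" and "\<And>v. v \<in> V \<Longrightarrow> 0 \<le> p v"
    and "\<And>v. v \<in> V \<Longrightarrow> 0 < p v \<Longrightarrow> q v \<noteq> 0"
  shows "KL V p q = ereal (\<Sum>v\<in>{v\<in>V. 0 < p v}. p v * ln (p v / q v))"
proof -
  have "(\<Sum>v\<in>V. if p v = 0 then 0 else p v * ln (p v / q v))
      = (\<Sum>v\<in>{v\<in>V. 0 < p v}. p v * ln (p v / q v))"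
    using assms(1,2) by (intro sum.mono_neutral_cong_right) (auto simp: less_le)
  moreover have "\<not> (\<exists>v\<in>V. p v > 0 \<and> q v = 0)" using assms(3) by blast
  ultimately show ?thesis by (simp add: KL_def)
qed

text \<open>Values off the support of \<open>p\<close> are invisible to the divergence. This later
  rules out a line that stands still on the support.\<close>

lemma KL_cong:
  assumes "\<And>v. v \<in> V \<Longrightarrow> p v \<noteq> 0 \<Longrightarrow> q v = r v"
  shows "KL V p q = KL V p r"
proof -
  have "(\<exists>v\<in>V. p v > 0 \<and> q v = 0) \<longleftrightarrow> (\<exists>v\<in>V. p v > 0 \<and> r v = 0)"
    using assms by fastforce
  moreover have "(\<Sum>v\<in>V. if p v = 0 then 0 else p v * ln (p v / q v))
      = (\<Sum>v\<in>V. if p v = 0 then 0 else p v * ln (p v / r v))"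
    using assms by (intro sum.cong) auto
  ultimately show ?thesis by (simp only: KL_def)
qed

lemma KL_finite_pos:
  assumes "KL V p q \<noteq> \<infinity>" and "v \<in> V" and "0 < p v" and "0 \<le> q v"
  shows "0 < q v"
proof -
  have "q v \<noteq> 0" using assms(1-3) unfolding KL_def by meson
  then show ?thesis using assms(4) by simp
qed

text \<open>Termwise, the convexity gap is \<open>p v\<close> times the concavity gap of
  \<open>ln\<close>; the point \<open>w\<close> makes one gap strict. Finiteness of both end values
  keeps every logarithm on the support at a positive argument.\<close>

lemma KL_strict_convex:
  assumes fin: "finite V" and p: "\<And>v. v \<in> V \<Longrightarrow> 0 \<le> p v"
    and q: "\<And>v. v \<in> V \<Longrightarrow> 0 \<le> q v" and r: "\<And>v. v \<in> V \<Longrightarrow> 0 \<le> r v"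
    and a: "KL V p q = ereal a" and b: "KL V p r = ereal b"
    and t: "0 < t" "t < 1"
    and w: "w \<in> V" "0 < p w" "q w \<noteq> r w"
  shows "KL V p (\<lambda>v. (1 - t) * q v + t * r v) < ereal ((1 - t) * a + t * b)"
proof -
  define S where "S = {v\<in>V. 0 < p v}"
  have qpos: "0 < q v" and rpos: "0 < r v" if "v \<in> S" for v
    using KL_finite_pos [of V p q v] KL_finite_pos [of V p r v] a b q r that
    by (auto simp: S_def)
  have mpos: "0 < (1 - t) * q v + t * r v" if "v \<in> S" for v
    using qpos [OF that] rpos [OF that] t by (simp add: add_pos_pos)
  have KLm: "KL V p (\<lambda>v. (1 - t) * q v + t * r v)
      = ereal (\<Sum>v\<in>S. p v * ln (p v / ((1 - t) * q v + t * r v)))"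
    unfolding S_def using mpos by (intro KL_eq_sum fin p) (force simp: S_def)+
  have a_eq: "a = (\<Sum>v\<in>S. p v * ln (p v / q v))"
    using KL_eq_sum [of V p q] fin p qpos a by (force simp: S_def)
  have b_eq: "b = (\<Sum>v\<in>S. p v * ln (p v / r v))"
    using KL_eq_sum [of V p r] fin p rpos b by (force simp: S_def)
  \<comment> \<open>The \<open>ln (p v)\<close> terms cancel because the weights
    \<open>1 - t\<close> and \<open>t\<close> sum to 1.\<close>
  have expand: "(1 - t) * (p v * ln (p v / q v)) + t * (p v * ln (p v / r v))
      - p v * ln (p v / ((1 - t) * q v + t * r v))
      = p v * (ln ((1 - t) * q v + t * r v) - ((1 - t) * ln (q v) + t * ln (r v)))"
    if "v \<in> S" for v
  proof -
    have "0 < p v" using that by (simp add: S_def)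
    then show ?thesis
      using qpos [OF that] rpos [OF that] mpos [OF that] by (simp add: ln_div algebra_simps)
  qed
  have "(\<Sum>v\<in>S. p v * ln (p v / ((1 - t) * q v + t * r v)))
      < (\<Sum>v\<in>S. (1 - t) * (p v * ln (p v / q v)) + t * (p v * ln (p v / r v)))"
  proof (rule sum_strict_mono_ex1)
    show "finite S" using fin by (simp add: S_def)
    show "\<forall>v\<in>S. p v * ln (p v / ((1 - t) * q v + t * r v))
        \<le> (1 - t) * (p v * ln (p v / q v)) + t * (p v * ln (p v / r v))"
    proof
      fix v assume v: "v \<in> S"
      have "0 \<le> p v * (ln ((1 - t) * q v + t * r v) - ((1 - t) * ln (q v) + t * ln (r v)))"
        using ln_concave_le(1) [OF qpos rpos t, OF v v] v by (simp add: S_def)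
      then show "p v * ln (p v / ((1 - t) * q v + t * r v))
        \<le> (1 - t) * (p v * ln (p v / q v)) + t * (p v * ln (p v / r v))"
        using expand [OF v] by linarith
    qed
    have wS: "w \<in> S" using w by (simp add: S_def)
    have "0 < p w * (ln ((1 - t) * q w + t * r w) - ((1 - t) * ln (q w) + t * ln (r w)))"
      using ln_concave_le(2) [OF qpos rpos t, OF wS wS] w by simp
    then show "\<exists>v\<in>S. p v * ln (p v / ((1 - t) * q v + t * r v))
        < (1 - t) * (p v * ln (p v / q v)) + t * (p v * ln (p v / r v))"
      using expand [OF wS] wS by (intro bexI [of _ w]) linarith+
  qed
  also have "\<dots> = (1 - t) * a + t * b"
    by (simp add: a_eq b_eq sum.distrib sum_distrib_left)
  finally show ?thesis by (simp add: KLm)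
qed

text \<open>Compactness is applied to the real-valued product \<open>F\<close>, whose zeros in
  \<open>I\<close> are exactly the points of infinite divergence; \<open>l0\<close> keeps its
  maximum positive.\<close>

lemma KL_attains_min:
  fixes q :: "'a::topological_space \<Rightarrow> 'v \<Rightarrow> real"
  assumes fin: "finite V" and p: "\<And>v. v \<in> V \<Longrightarrow> 0 \<le> p v"
    and I: "compact I" and cont: "\<And>v. v \<in> V \<Longrightarrow> continuous_on I (\<lambda>l. q l v)"
    and q: "\<And>l v. l \<in> I \<Longrightarrow> v \<in> V \<Longrightarrow> 0 \<le> q l v"
    and l0: "l0 \<in> I" "KL V p (q l0) \<noteq> \<infinity>"
  shows "\<exists>l\<in>I. \<forall>y\<in>I. KL V p (q l) \<le> KL V p (q y)"
proof -
  define S where "S = {v\<in>V. 0 < p v}"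
  have S: "finite S" using fin by (simp add: S_def)
  define F where "F l = (\<Prod>v\<in>S. q l v powr p v)" for l
  \<comment> \<open>The exponents are positive on \<open>S\<close>, so \<open>powr\<close> stays
    continuous where its base reaches 0.\<close>
  have "continuous_on I F"
    unfolding F_def using q cont
    by (intro continuous_on_prod continuous_on_powr' continuous_on_const) (auto simp: S_def)
  then obtain l where l: "l \<in> I" and max: "\<And>y. y \<in> I \<Longrightarrow> F y \<le> F l"
    using continuous_attains_sup [OF I] l0(1) by blast
  have Fpos: "0 < F y" and F_eq: "KL V p (q y) = ereal ((\<Sum>v\<in>S. p v * ln (p v)) - ln (F y))"
    if "\<And>v. v \<in> S \<Longrightarrow> 0 < q y v" for y
  proof -
    show "0 < F y" unfolding F_def using that by (force intro: prod_pos)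
    have "ln (F y) = (\<Sum>v\<in>S. p v * ln (q y v))"
      unfolding F_def using that S by (subst ln_prod) (force simp: ln_powr)+
    moreover have "KL V p (q y) = ereal (\<Sum>v\<in>S. p v * ln (p v / q y v))"
      unfolding S_def using that by (intro KL_eq_sum fin p) (force simp: S_def)+
    moreover have "p v * ln (p v / q y v) = p v * ln (p v) - p v * ln (q y v)" if "v \<in> S" for v
      using that \<open>\<And>v. v \<in> S \<Longrightarrow> 0 < q y v\<close> [OF that]
      by (simp add: S_def ln_div algebra_simps)
    ultimately show "KL V p (q y) = ereal ((\<Sum>v\<in>S. p v * ln (p v)) - ln (F y))"
      by (simp add: sum_subtractf)
  qed
  have finite_pos: "0 < q y v" if "y \<in> I" "KL V p (q y) \<noteq> \<infinity>" "v \<in> S" for y v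
    using KL_finite_pos [OF that(2)] that q by (simp add: S_def)
  \<comment> \<open>Since \<open>F l \<ge> F l0 > 0\<close>, no factor vanishes at the maximiser, so
    the divergence is finite there.\<close>
  have Fl: "0 < F l" using Fpos [OF finite_pos [OF l0]] max [OF l0(1)] by simp
  have lpos: "0 < q l v" if "v \<in> S" for v
  proof -
    have "q l v \<noteq> 0"
    proof
      assume "q l v = 0"
      then have "F l = 0" unfolding F_def using that S by (intro prod_zero) auto
      then show False using Fl by simp
    qed
    then show ?thesis using q l that by (force simp: S_def less_le)
  qed
  have "KL V p (q l) \<le> KL V p (q y)" if y: "y \<in> I" for y
  proof (cases "KL V p (q y) = \<infinity>")
    case False
    have "ln (F y) \<le> ln (F l)" using Fpos [OF finite_pos [OF y False]] max [OF y] Fl by simp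
    then show ?thesis using F_eq [OF finite_pos [OF y False]] F_eq [OF lpos] by simp
  qed simp
  then show ?thesis using l by blast
qed

lemma extrapolate_convex_comb:
  "extrapolate p' pm ((1 - t) * a + t * b)
    = (\<lambda>v. (1 - t) * extrapolate p' pm a v + t * extrapolate p' pm b v)"
  by (simp add: extrapolate_def algebra_simps)

text \<open>The coordinate at \<open>w\<close> is affine in \<open>l\<close> with nonzero slope
  \<open>d\<close>, and lies in the unit interval both at 0 and at \<open>l\<close>; hence
  \<open>\<bar>l * d\<bar> \<le> 1\<close>.\<close>

lemma compact_admissible:
  assumes fin: "finite V" and p': "prob_dist V p'" and pm: "prob_dist V pm"
    and w: "w \<in> V" "p' w \<noteq> pm w"
  shows "compact (admissible V p' pm)"
proof -
  define d where "d = p' w - pm w"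
  have d: "d \<noteq> 0" using w by (simp add: d_def)
  note eq = admissible_eq_Inter [OF fin p' pm]
  have "closed (admissible V p' pm)"
    unfolding eq by (intro closed_INT ballI closed_Collect_conj closed_Collect_le continuous_intros)
  moreover have "norm l \<le> 1 / \<bar>d\<bar>" if "l \<in> admissible V p' pm" for l
  proof -
    have "0 \<in> admissible V p' pm"
      using p' by (simp add: admissible_def extrapolate_def)
    then have "0 \<le> p' w" "p' w \<le> 1" using w unfolding eq by auto
    moreover have "0 \<le> p' w + l * d" "p' w + l * d \<le> 1"
      using that w unfolding eq by (auto simp: d_def algebra_simps)
    ultimately have "\<bar>l * d\<bar> \<le> 1" by linarith
    then show ?thesis using d by (simp add: field_simps abs_mult)
  qed
  ultimately show ?thesis by (auto simp: compact_eq_bounded_closed bounded_iff)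
qed

theorem theorem1:
  fixes V :: "'v set" and p_h p_h' p_m :: "'v \<Rightarrow> real"
    and g :: "real \<Rightarrow> ereal" and I :: "real set" and D :: real
  assumes "finite V" and "V \<noteq> {}"
    and "prob_dist V p_h" and "prob_dist V p_h'" and "prob_dist V p_m"
    and g: "\<And>l. g l = KL V p_h (extrapolate p_h' p_m l)"
    and I: "I = admissible V p_h' p_m"
    and "0 \<in> interior I"
    and "\<forall>\<^sub>F l in nhds 0. \<bar>g l\<bar> \<noteq> \<infinity>"
    and "((\<lambda>l. real_of_ereal (g l)) has_real_derivative D) (at 0)"
    and "D < 0"
  shows "(\<exists>!l_min. is_arg_min g (\<lambda>l. l \<in> I) l_min) \<and>
    (\<forall>l_min. is_arg_min g (\<lambda>l. l \<in> I) l_min \<longrightarrow>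
      0 < l_min \<and>
      (\<forall>l\<in>{0<..l_min}. KL V p_h (extrapolate p_h' p_m l) < KL V p_h p_h'))"
proof -
  have ph: "\<And>v. v \<in> V \<Longrightarrow> 0 \<le> p_h v" using assms(3) by (simp add: prob_dist_def)
  have q0: "\<And>l v. l \<in> I \<Longrightarrow> v \<in> V \<Longrightarrow> 0 \<le> extrapolate p_h' p_m l v"
    by (simp add: I admissible_def prob_dist_def)
  have I0: "0 \<in> I" using assms(8) interior_subset by blast
  have g0: "\<bar>g 0\<bar> \<noteq> \<infinity>" by (rule eventually_nhds_x_imp_x [OF assms(9)])
  have g_bot: "g l \<noteq> -\<infinity>" for l by (simp add: g KL_def)
  obtain d where d: "0 < d"
    and dec: "\<And>h. 0 < h \<Longrightarrow> h < d \<Longrightarrow> real_of_ereal (g h) < real_of_ereal (g 0)"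
    using DERIV_neg_dec_right [OF assms(10,11)] by auto
  obtain e where e: "0 < e" "\<And>l. \<bar>l\<bar> < e \<Longrightarrow> \<bar>g l\<bar> \<noteq> \<infinity>"
    using assms(9) by (auto simp: eventually_nhds_metric dist_real_def)
  obtain e' where e': "0 < e'" "ball 0 e' \<subseteq> I" using assms(8) by (auto simp: mem_interior)
  \<comment> \<open>Below \<open>d\<close> the function decreases, below \<open>e\<close> it is
    finite, and below \<open>e'\<close> the point is admissible; halving makes all three bounds
    strict.\<close>
  define s where "s = min d (min e e') / 2"
  have s: "0 < s" "s < d" "s < e" "s < e'" using d e(1) e'(1) by (auto simp: s_def)
  have sI: "s \<in> I" using e'(2) s by (auto simp: subset_iff)
  \<comment> \<open>\<open>real_of_ereal\<close> sends infinities to 0, so the real inequality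
    transfers only because both values are finite.\<close>
  have gs: "g s < g 0"
    using dec [OF s(1,2)] e(2) [of s] g0 s by (cases "g s"; cases "g 0") auto
  \<comment> \<open>If \<open>p_h'\<close> and \<open>p_m\<close> agreed on the support of
    \<open>p_h\<close>, then \<open>g s = g 0\<close>, contradicting the strict decrease.\<close>
  obtain w where w: "w \<in> V" "0 < p_h w" "p_h' w \<noteq> p_m w"
  proof (rule ccontr)
    assume "\<not> thesis"
    then have same: "\<And>v. v \<in> V \<Longrightarrow> 0 < p_h v \<Longrightarrow> p_m v = p_h' v" using that by metis
    have "extrapolate p_h' p_m s v = extrapolate p_h' p_m 0 v" if "v \<in> V" "p_h v \<noteq> 0" for v
      using same [of v] ph [of v] that by (simp add: extrapolate_def algebra_simps)
    then have "g s = g 0"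
      unfolding g by (rule KL_cong)
    then show False using gs by simp
  qed
  have move: "extrapolate p_h' p_m a w \<noteq> extrapolate p_h' p_m b w" if "a \<noteq> b" for a b
  proof -
    have "extrapolate p_h' p_m a w - extrapolate p_h' p_m b w = (a - b) * (p_h' w - p_m w)"
      by (simp add: extrapolate_def algebra_simps)
    then show ?thesis using that w(3) by (metis mult_eq_0_iff right_minus_eq)
  qed
  \<comment> \<open>Strictly between two points, \<open>g\<close> lies below its larger end value.
    This serves uniqueness, positivity and the final estimate.\<close>
  have below_max: "g ((1 - t) * a + t * b) < g a"
    if "a \<in> I" "b \<in> I" "a \<noteq> b" "0 < t" "t < 1" and ba: "g b \<le> g a" and fin: "g a \<noteq> \<infinity>" for a b t
  proof -
    obtain x where x: "g a = ereal x" using fin g_bot [of a] by (cases "g a") auto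
    obtain y where y: "g b = ereal y" using ba g_bot [of b] x by (cases "g b") auto
    have "g ((1 - t) * a + t * b) < ereal ((1 - t) * x + t * y)"
      unfolding g extrapolate_convex_comb
      by (rule KL_strict_convex [where w = w])
        (use assms(1) ph q0 that w move x [unfolded g] y [unfolded g] in simp_all)
    also have "(1 - t) * x + t * y \<le> x"
      using that ba x y mult_left_mono [of y x t] by (simp add: algebra_simps)
    finally show ?thesis by (simp add: x)
  qed
  have "\<exists>l\<in>I. \<forall>y\<in>I. KL V p_h (extrapolate p_h' p_m l) \<le> KL V p_h (extrapolate p_h' p_m y)"
  proof (rule KL_attains_min)
    show "compact I" unfolding I by (rule compact_admissible [OF assms(1,4,5) w(1,3)])
    show "continuous_on I (\<lambda>l. extrapolate p_h' p_m l v)" for v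
      unfolding extrapolate_def by (intro continuous_intros)
    show "KL V p_h (extrapolate p_h' p_m 0) \<noteq> \<infinity>" using g0 g [of 0] by auto
  qed (use assms(1) ph q0 I0 in auto)
  then have ex: "\<exists>l. is_arg_min g (\<lambda>l. l \<in> I) l"
    unfolding is_arg_min_def g [symmetric] by (meson not_less)
  have min_le: "g l \<le> g y" if "is_arg_min g (\<lambda>l. l \<in> I) l" "y \<in> I" for l y
    using that by (auto simp: is_arg_min_def not_less)
  have min_I: "l \<in> I" if "is_arg_min g (\<lambda>l. l \<in> I) l" for l
    using that by (simp add: is_arg_min_def)
  have min_fin: "g l \<noteq> \<infinity>" if "is_arg_min g (\<lambda>l. l \<in> I) l" for l
    using min_le [OF that I0] g0 by auto
  have "convex I"
  proof -
    have "extrapolate p_h' p_m ((1 - t) * a + t * b) v \<ge> 0"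
      if "a \<in> I" "b \<in> I" "0 \<le> t" "t \<le> 1" "v \<in> V" for a b t v
      using q0 that by (simp add: extrapolate_convex_comb)
    moreover have "(\<Sum>v\<in>V. extrapolate p_h' p_m l v) = 1" for l
      using assms(4,5)
      by (simp add: prob_dist_def extrapolate_def sum_subtractf sum_distrib_left [symmetric])
    ultimately show ?thesis
      unfolding convex_alt by (simp add: I admissible_def prob_dist_def)
  qed
  have unique: "a = b"
    if a: "is_arg_min g (\<lambda>l. l \<in> I) a" and b: "is_arg_min g (\<lambda>l. l \<in> I) b" for a b
  proof (rule ccontr)
    assume "a \<noteq> b"
    \<comment> \<open>The midpoint of two distinct minimisers would be admissible and have a smaller
      value.\<close>
    then have "g ((1 - 1/2) * a + 1/2 * b) < g a"
      by (intro below_max min_I a b min_le min_fin) auto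
    moreover have "(1 - 1/2) * a + 1/2 * b \<in> I"
      using convexD_alt [OF \<open>convex I\<close> min_I [OF a] min_I [OF b], of "1/2"] by simp
    ultimately show False using min_le [OF a] by (meson not_less)
  qed
  have pos: "0 < l" if l: "is_arg_min g (\<lambda>l. l \<in> I) l" for l
  proof (rule ccontr)
    assume "\<not> 0 < l"
    have ls: "g l \<le> g s" using min_le [OF l sI] .
    then have "l < 0" using gs \<open>\<not> 0 < l\<close> by (cases "l = 0") auto
    \<comment> \<open>The weight of \<open>s\<close> that puts 0 on the segment from
      \<open>l\<close> to \<open>s\<close>; then \<open>g 0 < g s\<close>, against the choice of
      \<open>s\<close>.\<close>
    define t where "t = - l / (s - l)"
    have "(1 - (1 - t)) * s + (1 - t) * l = 0"
      using \<open>l < 0\<close> s(1) by (simp add: t_def field_simps)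
    moreover have "g ((1 - (1 - t)) * s + (1 - t) * l) < g s"
      using \<open>l < 0\<close> s(1) gs
      by (intro below_max sI min_I l ls) (auto simp: t_def field_simps)
    ultimately show False using gs by simp
  qed
  have "g m < g 0" if l: "is_arg_min g (\<lambda>l. l \<in> I) l" and m: "m \<in> {0<..l}" for l m
  proof (cases "m = l")
    case True
    then show ?thesis using min_le [OF l sI] gs by simp
  next
    case False
    \<comment> \<open>The combination equals \<open>m\<close>, and \<open>m / l\<close> lies
      strictly between 0 and 1.\<close>
    have "g ((1 - m / l) * 0 + m / l * l) < g 0"
      using m False g0 by (intro below_max I0 min_I l min_le) auto
    then show ?thesis using m by simp
  qed
  then have "KL V p_h (extrapolate p_h' p_m m) < KL V p_h p_h'"
    if "is_arg_min g (\<lambda>l. l \<in> I) l" "m \<in> {0<..l}" for l m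
    using that by (simp add: g extrapolate_def)
  then show ?thesis using ex unique pos by blast
qed

end
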